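(* There is a constant $c>0$ such that for all integers $n\ge 1$, $$f_T(n)\geq e^{c\sqrt{\log n}},$$ where $f_T(n)$ is the minimum of $t(G)$ over all connected triangle-free graphs $G$ on $n$ vertices, and $t(G)$ is the maximum number of vertices of an induced subgraph of $G$ that is a tree.
   Context: All graphs are finite, simple and undirected. For a graph $G$, $t(G)$ denotes the maximum number of vertices of an induced subgraph of $G$ that is a tree (i.e., connected and acyclic). For a positive integer $n$, $f_T(n)=\min\{t(G) : |V(G)|=n,\ G \text{ connected and triangle-free}\}$. Here $\log$ is the natural logarithm. *)

theory Defs
  imports Complex_Main "Graph_Theory.Graph_Theory"
begin

text \<open>
  A finite simple undirected graph is a finite symmetric loop-free digraph without parallel arcs
  (\<^locale>\<open>graph\<close>, and \<^locale>\<open>pair_graph\<close> when arcs are pairs of vertices). The name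
  \<open>connected\<close> is always qualified, because the topological notion has the same name; graph
  connectedness includes that there is at least one vertex.
\<close>

text \<open>
  In a symmetric digraph the closed walk \<open>a, b, a\<close> along an edge counts as a
  \<^const>\<open>pre_digraph.cycle\<close>, so \<^const>\<open>forest\<close> and \<^const>\<open>tree\<close> do not mean
  what they mean for undirected graphs. The cycles of a simple undirected graph are the ones of
  length at least 3.
\<close>

definition ugraph_acyclic :: "('a, 'b) pre_digraph \<Rightarrow> bool" where
  "ugraph_acyclic G \<longleftrightarrow> \<not> (\<exists>p. pre_digraph.cycle G p \<and> 3 \<le> length p)"

definition ugraph_tree :: "('a, 'b) pre_digraph \<Rightarrow> bool" where
  "ugraph_tree G \<longleftrightarrow> Digraph_Component.connected G \<and> ugraph_acyclic G"

definition triangle_free :: "('a, 'b) pre_digraph \<Rightarrow> bool" where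
  "triangle_free G \<longleftrightarrow>
     \<not> (\<exists>u v w. u \<rightarrow>\<^bsub>G\<^esub> v \<and> v \<rightarrow>\<^bsub>G\<^esub> w \<and> w \<rightarrow>\<^bsub>G\<^esub> u)"

definition max_induced_tree :: "('a, 'b) pre_digraph \<Rightarrow> nat" where
  "max_induced_tree G = Max {card (verts H) | H. induced_subgraph H G \<and> ugraph_tree H}"

text \<open>
  Every finite graph is isomorphic to one whose vertices are natural numbers, so ranging over
  graphs with vertices in \<^typ>\<open>nat\<close> loses nothing.
\<close>

definition f_T :: "nat \<Rightarrow> nat" where
  "f_T n = Min {max_induced_tree (with_proj G) | G :: nat pair_pre_digraph.
     pair_graph G \<and> card (pverts G) = n \<and>
     Digraph_Component.connected (with_proj G) \<and> triangle_free (with_proj G)}"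

text \<open>
  The maximum and (for \<open>n \<ge> 1\<close>) the minimum are taken over finite nonempty sets.
\<close>

lemma max_induced_tree_finite:
  assumes "finite (verts G)"
  shows "finite {card (verts H) | H. induced_subgraph H G \<and> ugraph_tree H}"
proof (rule finite_subset)
  show "{card (verts H) | H. induced_subgraph H G \<and> ugraph_tree H} \<subseteq> {..card (verts G)}"
    using assms by (auto simp: induced_subgraph_def subgraph_def intro: card_mono)
qed simp

lemma (in graph) max_induced_tree_nonempty:
  assumes "verts G \<noteq> {}"
  shows "{card (verts H) | H. induced_subgraph H G \<and> ugraph_tree H} \<noteq> {}"
proof -
  from assms obtain v where v: "v \<in> verts G" by blast
  let ?H = "G \<restriction> {v}"
  have arcs: "arcs ?H = {}" using no_loops by fastforce
  have "Digraph_Component.connected ?H"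
    unfolding connected_def strongly_connected_def mk_symmetric_def
    by (auto simp: reachable_def)
  moreover have "ugraph_acyclic ?H"
    unfolding ugraph_acyclic_def pre_digraph.cycle_def pre_digraph.awalk_def
    unfolding arcs by simp
  ultimately have "ugraph_tree ?H" by (simp add: ugraph_tree_def)
  moreover have "induced_subgraph ?H G" using v by (intro induced_induce) simp
  ultimately show ?thesis by blast
qed

lemma max_induced_tree_le:
  assumes "graph G" "verts G \<noteq> {}"
  shows "max_induced_tree G \<le> card (verts G)"
proof -
  interpret graph G by fact
  have "max_induced_tree G \<in> {card (verts H) | H. induced_subgraph H G \<and> ugraph_tree H}"
    unfolding max_induced_tree_def
    by (intro Max_in max_induced_tree_finite max_induced_tree_nonempty assms finite_verts)
  then show ?thesis
    by (auto simp: induced_subgraph_def subgraph_def intro!: card_mono finite_verts)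
qed

lemma f_T_finite:
  "finite {max_induced_tree (with_proj G) | G :: nat pair_pre_digraph.
     pair_graph G \<and> card (pverts G) = n \<and>
     Digraph_Component.connected (with_proj G) \<and> triangle_free (with_proj G)}" (is "finite ?A")
proof (rule finite_subset)
  have "max_induced_tree (with_proj G) \<le> card (pverts G)"
    if G: "pair_graph G" and c: "Digraph_Component.connected (with_proj G)"
    for G :: "nat pair_pre_digraph"
  proof -
    have "graph (with_proj G)" using G by (rule pair_graph.pair_graphD_graph)
    moreover have "verts (with_proj G) \<noteq> {}"
      using c by (auto simp: connected_def strongly_connected_def mk_symmetric_def)
    ultimately show ?thesis
      using max_induced_tree_le by fastforce
  qed
  then show "?A \<subseteq> {..n}" by blast
qed simp

lemma f_T_nonempty:
  assumes "n \<ge> 1"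
  shows "{max_induced_tree (with_proj G) | G :: nat pair_pre_digraph.
     pair_graph G \<and> card (pverts G) = n \<and>
     Digraph_Component.connected (with_proj G) \<and> triangle_free (with_proj G)} \<noteq> {}"
proof -
  define E :: "nat rel" where "E = {0} \<times> {1..<n} \<union> {1..<n} \<times> {0}"
  define G where "G = \<lparr>pverts = {..<n}, parcs = E\<rparr>"
  have [simp]: "pverts G = {..<n}" "parcs G = E" by (simp_all add: G_def)
  have fin: "finite E" by (simp add: E_def)
  have pg: "pair_graph G"
    using assms fin
    by unfold_locales (auto simp: E_def symmetric_def sym_def)
  interpret pair_graph G by (fact pg)
  have mk: "mk_symmetric (with_proj G) = G"
    by (auto simp: mk_symmetric_def G_def E_def)
  have to0: "v \<rightarrow>\<^sup>*\<^bsub>with_proj G\<^esub> 0" and from0: "0 \<rightarrow>\<^sup>*\<^bsub>with_proj G\<^esub> v" if "v < n" for v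
  proof -
    show "v \<rightarrow>\<^sup>*\<^bsub>with_proj G\<^esub> 0"
    proof (cases "v = 0")
      case False
      then have "(v, 0) \<in> E" using that by (auto simp: E_def)
      then show ?thesis by (intro reachable_adjI) simp
    qed (use assms in auto)
    show "0 \<rightarrow>\<^sup>*\<^bsub>with_proj G\<^esub> v"
    proof (cases "v = 0")
      case False
      then have "(0, v) \<in> E" using that by (auto simp: E_def)
      then show ?thesis by (intro reachable_adjI) simp
    qed (use assms in auto)
  qed
  have "strongly_connected (with_proj G)"
    unfolding strongly_connected_def
  proof (intro conjI ballI)
    show "verts (with_proj G) \<noteq> {}" using assms by (auto simp: lessThan_empty_iff)
    fix u v assume "u \<in> verts (with_proj G)" "v \<in> verts (with_proj G)"
    then show "u \<rightarrow>\<^sup>*\<^bsub>with_proj G\<^esub> v"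
      using to0[of u] from0[of v] reachable_trans by auto
  qed
  then have "Digraph_Component.connected (with_proj G)"
    by (simp add: connected_def mk)
  moreover have "triangle_free (with_proj G)"
    by (auto simp: triangle_free_def E_def)
  moreover have "card (pverts G) = n" by simp
  ultimately show ?thesis using pg by blast
qed

end

theory Submission
  imports Defs
begin

text \<open>
  The bound proved is the stronger \<open>f\<^sub>T(n) \<ge> n\<^bsup>1/11\<^esup>\<close>, by induction on \<open>n\<close>, for induced trees
  containing a prescribed root \<open>v\<close>. Let \<open>A\<close> be the neighbourhood of \<open>v\<close>, an independent set by
  triangle-freeness, and let \<open>B\<close> be the set of components of the graph without \<open>v\<close> and \<open>A\<close>. Every
  component has a neighbour in \<open>A\<close>. For any \<open>A' \<subseteq> A\<close>, the star on \<open>v\<close> and \<open>A'\<close> can be extended, inside each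
  component \<open>b\<close> with exactly one neighbour \<open>u\<close> in \<open>A'\<close>, by a tree rooted at \<open>u\<close> that the induction
  provides in \<open>b \<union> {u}\<close>. Hence the largest tree order \<open>Z\<close> bounds all such unique coverings. A minimal
  cover shows that at most \<open>Z\<^sup>2/k\<^sup>2\<close> components give trees with at least \<open>k\<close> further vertices, and
  any two components can be used together; so the largest component is compensated by the second
  largest one, and a power sum over the others is absorbed by the exponent 11.
\<close>

section \<open>Power sums bounded through unique coverings\<close>

text \<open>The \<open>j\<close>-th largest value is at most \<open>sqrt (K / j)\<close>, so the sum
  is at most \<open>K^2\<close> times the sum of \<open>1 / j^2\<close>, which is below 2.\<close>

lemma sum_fourth_powers_le:
  fixes y :: "'b \<Rightarrow> nat"
  assumes "finite B"
    and "\<And>B' k. B' \<subseteq> B \<Longrightarrow> \<forall>b\<in>B'. k \<le> y b \<Longrightarrow> card B' * k\<^sup>2 \<le> K"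
  shows "(\<Sum>b\<in>B. y b ^ 4) \<le> 2 * K\<^sup>2"
proof -
  \<comment> \<open>The extra term reflects that the sum of \<open>1 / j^2\<close> up to
    \<open>n\<close> is at most \<open>2 - 1 / n\<close>. It lets the induction peel off the
    smallest value; for empty \<open>B\<close> it is 0, as division by zero gives 0.\<close>
  have "real (\<Sum>b\<in>B. y b ^ 4) + (real K)\<^sup>2 / card B \<le> 2 * (real K)\<^sup>2"
    using assms
  proof (induction "card B" arbitrary: B)
    case 0
    then show ?case by simp
  next
    case (Suc n)
    then have "B \<noteq> {}" by auto
    then obtain b where b: "b \<in> B" "\<forall>c\<in>B. y b \<le> y c"
      using Suc.prems(1) ex_min_if_finite[of "y ` B"] by (metis arg_min_if_finite(1) arg_min_least)
    have "Suc n * (y b)\<^sup>2 \<le> K"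
      using Suc.prems(2)[of B "y b"] Suc.hyps(2) b by simp
    then have "real (Suc n) * (real (y b))\<^sup>2 \<le> real K"
      by (metis of_nat_le_iff of_nat_mult of_nat_power)
    then have "(real (Suc n) * (real (y b))\<^sup>2)\<^sup>2 \<le> (real K)\<^sup>2"
      by (intro power_mono) (auto simp del: of_nat_Suc)
    then have yb: "real (y b) ^ 4 \<le> (real K)\<^sup>2 / (real (Suc n))\<^sup>2"
      by (simp add: field_simps power_mult_distrib del: of_nat_Suc flip: power_mult)
    have IH: "real (\<Sum>b\<in>B - {b}. y b ^ 4) + (real K)\<^sup>2 / card (B - {b}) \<le> 2 * (real K)\<^sup>2"
    proof (rule Suc.hyps(1))
      show "card B' * k\<^sup>2 \<le> K" if "B' \<subseteq> B - {b}" "\<forall>b\<in>B'. k \<le> y b" for B' k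
        using Suc.prems(2) that by (meson Diff_subset order_trans)
    qed (use Suc.prems Suc.hyps(2) b in auto)
    have card: "card (B - {b}) = n"
      using Suc.hyps(2) b Suc.prems(1) by simp
    have sum: "real (\<Sum>b\<in>B. y b ^ 4) = real (y b) ^ 4 + real (\<Sum>b\<in>B - {b}. y b ^ 4)"
      using Suc.prems(1) b by (simp add: sum.remove[of B b])
    \<comment> \<open>A single value is separate: the telescoping inequality fails at
      \<open>n = 0\<close>, where \<open>1 / n\<close> is 0.\<close>
    show ?case
    proof (cases "n = 0")
      case True
      then have "B - {b} = {}" using card Suc.prems(1) by simp
      then have "(\<Sum>b\<in>B - {b}. y b ^ 4) = 0" by (simp only: sum.empty)
      with sum yb True show ?thesis by (simp flip: Suc.hyps(2))
    next
      case False
      then have "1 / (real (Suc n))\<^sup>2 + 1 / Suc n \<le> 1 / n"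
        by (simp add: divide_simps) (simp add: power2_eq_square algebra_simps)
      from mult_left_mono[OF this, of "(real K)\<^sup>2"]
      have "(real K)\<^sup>2 / (real (Suc n))\<^sup>2 + (real K)\<^sup>2 / Suc n \<le> (real K)\<^sup>2 / n"
        by (simp add: distrib_left del: of_nat_Suc)
      with sum yb IH card show ?thesis by (simp del: of_nat_Suc of_nat_sum flip: Suc.hyps(2))
    qed
  qed
  moreover have "0 \<le> (real K)\<^sup>2 / card B" by simp
  ultimately have "real (\<Sum>b\<in>B. y b ^ 4) \<le> 2 * (real K)\<^sup>2" by linarith
  then have "real (\<Sum>b\<in>B. y b ^ 4) \<le> real (2 * K\<^sup>2)"
    by (simp only: of_nat_mult of_nat_power of_nat_numeral)
  then show ?thesis by (simp only: of_nat_le_iff)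
qed

text \<open>Each member of a minimal cover \<open>C\<close> has a private element of
  \<open>B\<close>, so \<open>C\<close> covers \<open>card C\<close> elements uniquely; a single
  \<open>a\<close> covers uniquely all \<open>b\<close> with \<open>a\<close> in \<open>N b\<close>.
  Hence \<open>card C * k\<close> and \<open>k\<close> times any degree are at most
  \<open>Z\<close>, while \<open>card B\<close> is at most the sum of the degrees over
  \<open>C\<close>.\<close>

lemma card_mult_power2_le_of_unique_covers:
  fixes Z k :: nat
  assumes "finite A" "finite B"
    and N: "\<And>b. b \<in> B \<Longrightarrow> N b \<subseteq> A \<and> N b \<noteq> {}"
    and Z: "\<And>A' B'. A' \<subseteq> A \<Longrightarrow> B' \<subseteq> B \<Longrightarrow> \<forall>b\<in>B'. card (N b \<inter> A') = 1 \<Longrightarrow> card B' * k \<le> Z"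
  shows "card B * k\<^sup>2 \<le> Z\<^sup>2"
proof -
  define P where "P A' \<longleftrightarrow> A' \<subseteq> A \<and> (\<forall>b\<in>B. N b \<inter> A' \<noteq> {})" for A'
  have "finite {A'. P A'}"
    by (rule finite_subset[of _ "Pow A"]) (auto simp: P_def assms)
  moreover have "P A" using N by (auto simp: P_def)
  ultimately obtain C where C: "P C" and min: "\<And>C'. P C' \<Longrightarrow> C' \<subseteq> C \<Longrightarrow> C' = C"
    using finite_has_minimal[of "{A'. P A'}"] by blast
  have finC: "finite C" using C assms(1) finite_subset by (auto simp: P_def)
  have "\<exists>b\<in>B. N b \<inter> C = {a}" if "a \<in> C" for a
  proof -
    have "\<not> P (C - {a})" using min[of "C - {a}"] that by auto
    then obtain b where b: "b \<in> B" "N b \<inter> (C - {a}) = {}"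
      using C by (auto simp: P_def)
    moreover have "N b \<inter> C \<noteq> {}" using C b by (auto simp: P_def)
    ultimately have "N b \<inter> C = {a}" by blast
    with b show ?thesis by blast
  qed
  then obtain p where p: "\<And>a. a \<in> C \<Longrightarrow> p a \<in> B \<and> N (p a) \<inter> C = {a}" by metis
  have "card (p ` C) = card C"
    by (rule card_image, rule inj_onI) (metis p singleton_inject)
  moreover have "card (p ` C) * k \<le> Z"
    by (rule Z[of C]) (use C p in \<open>auto simp: P_def\<close>)
  ultimately have Ck: "card C * k \<le> Z" by simp
  have "card {b \<in> B. a \<in> N b} * k \<le> Z" if "a \<in> C" for a
    by (rule Z[of "{a}"]) (use C that in \<open>auto simp: P_def\<close>)
  then have "(\<Sum>a\<in>C. card {b \<in> B. a \<in> N b}) * k \<le> card C * Z"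
    using sum_bounded_above[of C "\<lambda>a. card {b \<in> B. a \<in> N b} * k" Z]
    by (simp add: sum_distrib_right)
  moreover have "card B \<le> (\<Sum>a\<in>C. card {b \<in> B. a \<in> N b})"
  proof -
    have "(\<Union>a\<in>C. {b \<in> B. a \<in> N b}) = B" using C by (auto simp: P_def)
    then show ?thesis using card_UN_le[OF finC, of "\<lambda>a. {b \<in> B. a \<in> N b}"] by simp
  qed
  ultimately have "card B * k \<le> card C * Z"
    by (meson le_trans mult_le_mono1)
  then have "card B * k * k \<le> card C * Z * k" by (rule mult_le_mono1)
  also have "\<dots> = (card C * k) * Z" by simp
  also have "\<dots> \<le> Z * Z" using Ck by (rule mult_le_mono1)
  finally show ?thesis by (simp add: power2_eq_square mult.assoc)
qed

text \<open>The numerical core of the induction. The exponent splits as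
  \<open>11 = 1 + 6 + 4\<close>: outside the largest component, one factor is bounded by the second
  largest value, six by \<open>Z / 2\<close>, and four enter the sum of fourth powers.\<close>

lemma sum_powers_le_of_unique_covers:
  fixes z :: "'b \<Rightarrow> nat" and Z :: nat
  assumes fin: "finite A" "finite B"
    and N: "\<And>b. b \<in> B \<Longrightarrow> N b \<subseteq> A \<and> N b \<noteq> {}"
    and z: "\<And>b. b \<in> B \<Longrightarrow> 2 \<le> z b"
    and Z: "\<And>A' B'. A' \<subseteq> A \<Longrightarrow> B' \<subseteq> B \<Longrightarrow> \<forall>b\<in>B'. card (N b \<inter> A') = 1 \<Longrightarrow>
      1 + card A' + (\<Sum>b\<in>B'. z b - 1) \<le> Z"
  shows "1 + card A + (\<Sum>b\<in>B. z b ^ 11 - 1) \<le> Z ^ 11"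
proof -
  have A: "1 + card A \<le> Z" using Z[of A "{}"] by simp
  then have Z10: "1 \<le> Z ^ 10" by simp
  show ?thesis
  proof (cases "B = {}")
    case True
    have "Z * 1 \<le> Z * Z ^ 10" using Z10 by (rule mult_le_mono2)
    then have "Z \<le> Z ^ 11" by (simp flip: power_Suc)
    with A True show ?thesis by simp
  next
    case False
    then have "Max (z ` B) \<in> z ` B" using fin by (intro Max_in) auto
    then obtain b1 where "b1 \<in> B" "z b1 = Max (z ` B)" by auto
    with fin have b1: "b1 \<in> B" "\<forall>b\<in>B. z b \<le> z b1" by simp_all
    have one: "z b1 + 1 \<le> Z"
    proof -
      obtain a where a: "a \<in> N b1" "a \<in> A" using N b1 by blast
      then show ?thesis using Z[of "{a}" "{b1}"] b1 z[of b1] by auto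
    qed
    have split: "(\<Sum>b\<in>B. z b ^ 11 - 1) = (z b1 ^ 11 - 1) + (\<Sum>b\<in>B - {b1}. z b ^ 11 - 1)"
      using fin b1 by (simp add: sum.remove)
    have z1: "1 \<le> z b1 ^ 11" using z[of b1] b1 by simp
    \<comment> \<open>The gap \<open>m\<close> between \<open>z b1\<close> and \<open>Z\<close> pays
      for everything except \<open>b1\<close>, up to \<open>m * Z ^ 10\<close>. It is 1 if
      \<open>b1\<close> is alone and \<open>z b2\<close> otherwise.\<close>
    have main: "1 + card A + (\<Sum>b\<in>B. z b ^ 11 - 1) \<le> Z ^ 11"
      if m: "1 \<le> m" "z b1 + m \<le> Z"
        "2 * (\<Sum>b\<in>B - {b1}. z b ^ 11 - 1) + 2 * card A \<le> 2 * m * Z ^ 10" for m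
    proof -
      have "z b1 ^ 11 = z b1 * z b1 ^ 10" by (simp flip: power_Suc)
      also have "\<dots> \<le> z b1 * Z ^ 10" using one by (intro mult_le_mono2 power_mono) auto
      finally have "z b1 ^ 11 + m * Z ^ 10 \<le> (z b1 + m) * Z ^ 10" by (simp add: distrib_right)
      also have "\<dots> \<le> Z * Z ^ 10" using m by (intro mult_le_mono1)
      also have "\<dots> = Z ^ 11" by (simp flip: power_Suc)
      finally show ?thesis using m split z1 by linarith
    qed
    have AZ: "card A \<le> Z ^ 10"
      using A self_le_power[of Z 10] by (simp add: le_trans)
    show ?thesis
    proof (cases "B - {b1} = {}")
      case True
      then have "(\<Sum>b\<in>B - {b1}. z b ^ 11 - 1) = 0" by (simp only: sum.empty)
      then show ?thesis using one AZ by (intro main[of 1]) linarith+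
    next
      case False
      then have "Max (z ` (B - {b1})) \<in> z ` (B - {b1})" using fin by (intro Max_in) auto
      then obtain b2 where "b2 \<in> B - {b1}" "z b2 = Max (z ` (B - {b1}))"
        by (metis (no_types, lifting) imageE)
      with fin have b2: "b2 \<in> B - {b1}" "\<forall>b\<in>B - {b1}. z b \<le> z b2" by simp_all
      then have b12: "b1 \<noteq> b2" by auto
      \<comment> \<open>A common neighbour yields exactly \<open>z b1 + z b2\<close>; disjoint
        neighbourhoods need two members of \<open>A\<close> and yield one more.\<close>
      have two: "z b1 + z b2 \<le> Z"
      proof (cases "N b1 \<inter> N b2 = {}")
        case True
        obtain a1 a2 where a: "a1 \<in> N b1" "a2 \<in> N b2" using N b1 b2 by blast
        with True have eq: "N b1 \<inter> {a1, a2} = {a1}" "N b2 \<inter> {a1, a2} = {a2}" "a1 \<noteq> a2" by auto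
        have "1 + card {a1, a2} + (\<Sum>b\<in>{b1, b2}. z b - 1) \<le> Z"
        proof (rule Z)
          show "{a1, a2} \<subseteq> A" using N[of b1] N[of b2] a b1 b2 by auto
          show "\<forall>b\<in>{b1, b2}. card (N b \<inter> {a1, a2}) = 1" using eq by simp
        qed (use b1 b2 in auto)
        then show ?thesis using eq b12 b1 b2 z[of b1] z[of b2] by simp
      next
        case False
        then obtain a where a: "a \<in> N b1" "a \<in> N b2" by blast
        have "1 + card {a} + (\<Sum>b\<in>{b1, b2}. z b - 1) \<le> Z"
        proof (rule Z)
          show "{a} \<subseteq> A" using N[of b1] a b1 by auto
          show "\<forall>b\<in>{b1, b2}. card (N b \<inter> {a}) = 1" using a by simp
        qed (use b1 b2 in auto)
        then show ?thesis using b12 b1 b2 z[of b1] z[of b2] by simp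
      qed
      have count: "card B' * k\<^sup>2 \<le> Z\<^sup>2" if "B' \<subseteq> B" "\<forall>b\<in>B'. k \<le> z b - 1" for B' k
      proof (rule card_mult_power2_le_of_unique_covers[OF fin(1), of B' N])
        show "finite B'" using that fin finite_subset by blast
        show "N b \<subseteq> A \<and> N b \<noteq> {}" if "b \<in> B'" for b using N \<open>B' \<subseteq> B\<close> that by blast
        fix A' C assume C: "A' \<subseteq> A" "C \<subseteq> B'" "\<forall>b\<in>C. card (N b \<inter> A') = 1"
        have "card C * k \<le> (\<Sum>b\<in>C. z b - 1)"
          using sum_bounded_below[of C k "\<lambda>b. z b - 1"] C(2) that(2) by (auto simp: subset_iff)
        also have "\<dots> \<le> Z" using Z[OF C(1) order_trans[OF C(2) that(1)] C(3)] by simp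
        finally show "card C * k \<le> Z" .
      qed
      have "(\<Sum>b\<in>B. (z b - 1) ^ 4) \<le> 2 * (Z\<^sup>2)\<^sup>2"
        by (rule sum_fourth_powers_le) (use fin count in auto)
      \<comment> \<open>From \<open>2 <= z b\<close> comes \<open>z b <= 2 * (z b - 1)\<close>,
        hence the factor \<open>16 = 2 ^ 4\<close>.\<close>
      moreover have "(\<Sum>b\<in>B. z b ^ 4) \<le> (\<Sum>b\<in>B. 16 * (z b - 1) ^ 4)"
      proof (rule sum_mono)
        fix b assume "b \<in> B"
        then have "z b ^ 4 \<le> (2 * (z b - 1)) ^ 4" using z[of b] by (intro power_mono) auto
        then show "z b ^ 4 \<le> 16 * (z b - 1) ^ 4" by (simp add: power_mult_distrib)
      qed
      ultimately have s4: "(\<Sum>b\<in>B. z b ^ 4) \<le> 32 * Z ^ 4"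
        by (simp flip: sum_distrib_left power_mult)
      \<comment> \<open>Six factors \<open>2 * z b <= Z\<close> gain 64, twice the 32 of
        \<open>s4\<close>. So the sum takes at most half of \<open>z b2 * Z ^ 10\<close> and leaves
        the other half for \<open>card A\<close>.\<close>
      have "(\<Sum>b\<in>B - {b1}. 64 * (z b ^ 11 - 1)) \<le> (\<Sum>b\<in>B - {b1}. z b2 * Z ^ 6 * z b ^ 4)"
      proof (rule sum_mono)
        fix b assume "b \<in> B - {b1}"
        then have "z b \<le> z b2" "z b \<le> z b1" using b1 b2 by blast+
        then have le: "z b \<le> z b2" "2 * z b \<le> Z" using two by linarith+
        have "64 * (z b ^ 11 - 1) \<le> 64 * z b ^ 11" by simp
        also have "\<dots> = 64 * (z b * z b ^ 6 * z b ^ 4)" by (simp flip: power_Suc power_add)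
        also have "\<dots> = z b * (2 * z b) ^ 6 * z b ^ 4" by (simp add: power_mult_distrib)
        also have "\<dots> \<le> z b2 * Z ^ 6 * z b ^ 4"
          using le by (intro mult_le_mono power_mono) simp_all
        finally show "64 * (z b ^ 11 - 1) \<le> z b2 * Z ^ 6 * z b ^ 4" .
      qed
      also have "\<dots> = z b2 * Z ^ 6 * (\<Sum>b\<in>B - {b1}. z b ^ 4)" by (simp add: sum_distrib_left)
      also have "\<dots> \<le> z b2 * Z ^ 6 * (32 * Z ^ 4)"
        using s4 sum_mono2[of B "B - {b1}" "\<lambda>b. z b ^ 4"] fin
        by (intro mult_le_mono2) (simp add: le_trans)
      also have "\<dots> = 32 * (z b2 * Z ^ 10)" by (simp flip: power_add)
      finally have "2 * (\<Sum>b\<in>B - {b1}. z b ^ 11 - 1) \<le> z b2 * Z ^ 10"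
        by (simp flip: sum_distrib_left)
      moreover have "2 * card A \<le> z b2 * Z ^ 10"
        using AZ z[of b2] b2 by (intro mult_le_mono) auto
      ultimately show ?thesis
        by (intro main[of "z b2"]) (use two z[of b2] b2 in auto)
    qed
  qed
qed

section \<open>Induced trees grown leaf by leaf\<close>

text \<open>For symmetric irreflexive \<open>E\<close>, a vertex with exactly one neighbour in the
  current set extends an induced tree by a leaf. In this form gluing, connectedness and acyclicity
  are all rule inductions.\<close>

inductive grown_tree :: "'a rel \<Rightarrow> 'a \<Rightarrow> 'a set \<Rightarrow> bool" for E r where
  root: "grown_tree E r {r}"
| leaf: "grown_tree E r S \<Longrightarrow> u \<in> S \<Longrightarrow> w \<notin> S \<Longrightarrow> {x \<in> S. (x, w) \<in> E} = {u} \<Longrightarrow>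
    grown_tree E r (insert w S)"

lemma grown_tree_root_mem: "grown_tree E r S \<Longrightarrow> r \<in> S"
  by (induction rule: grown_tree.induct) auto

lemma grown_tree_finite: "grown_tree E r S \<Longrightarrow> finite S"
  by (induction rule: grown_tree.induct) auto

text \<open>The growth of \<open>T\<close> is replayed on top of \<open>S\<close>: without edges
  across, each new vertex still sees only its parent in \<open>T\<close>.\<close>

lemma grown_tree_union:
  assumes "grown_tree E u T" "grown_tree E r S" "S \<inter> T = {u}"
    and "\<And>x y. x \<in> S - {u} \<Longrightarrow> y \<in> T - {u} \<Longrightarrow> (x, y) \<notin> E"
  shows "grown_tree E r (S \<union> T)"
  using assms
proof (induction rule: grown_tree.induct)
  case root
  then have "S \<union> {u} = S" by auto
  with root show ?case by simp
next
  case (leaf T t w)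
  have "u \<in> T" using leaf.hyps(1) by (rule grown_tree_root_mem)
  then have w: "w \<notin> S \<union> T" using leaf by auto
  have "grown_tree E r (S \<union> T)" using leaf \<open>u \<in> T\<close> by auto
  moreover have "{x \<in> S \<union> T. (x, w) \<in> E} = {t}"
    using leaf.hyps leaf.prems(3) \<open>u \<in> T\<close> w by blast
  ultimately have "grown_tree E r (insert w (S \<union> T))"
    using leaf.hyps w by (intro grown_tree.leaf[of _ _ "S \<union> T" t]) auto
  then show ?case by simp
qed

lemma grown_tree_star:
  assumes "finite A" "v \<notin> A" "\<And>a. a \<in> A \<Longrightarrow> (v, a) \<in> E"
    and "\<And>a b. a \<in> A \<Longrightarrow> b \<in> A \<Longrightarrow> (a, b) \<notin> E"
  shows "grown_tree E v (insert v A)"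
  using assms
proof (induction A)
  case empty
  then show ?case by (simp add: grown_tree.root)
next
  case (insert a A)
  have "{x \<in> insert v A. (x, a) \<in> E} = {v}" using insert.prems by blast
  with insert have "grown_tree E v (insert a (insert v A))"
    by (intro grown_tree.leaf[of _ _ "insert v A" v]) auto
  then show ?case by (simp add: insert_commute)
qed

lemma grown_tree_rtrancl_on:
  assumes "grown_tree E r S" "sym E" "x \<in> S"
  shows "(r, x) \<in> rtrancl_on S E"
  using assms
proof (induction arbitrary: x rule: grown_tree.induct)
  case root
  then show ?case by auto
next
  case (leaf S u w)
  have mono: "(r, x) \<in> rtrancl_on (insert w S) E" if "x \<in> S" for x
    using leaf.IH[OF leaf.prems(1) that] by (auto intro: rtrancl_on_mono)
  show ?case
  proof (cases "x = w")
    case True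
    have "(u, w) \<in> E" using leaf.hyps by auto
    then show ?thesis using mono[of u] leaf.hyps True
      by (auto intro: rtrancl_on_into_rtrancl_on)
  next
    case False
    then show ?thesis using leaf.prems mono by auto
  qed
qed

text \<open>The member of \<open>C\<close> added last would have two neighbours already present, but
  a leaf has only one. Applied to the vertices of a cycle, this excludes cycles.\<close>

lemma grown_tree_no_core:
  assumes "grown_tree E r S" "sym E" "irrefl E" "C \<subseteq> S"
    and "\<And>c. c \<in> C \<Longrightarrow> \<exists>x\<in>C. \<exists>y\<in>C. x \<noteq> y \<and> (x, c) \<in> E \<and> (y, c) \<in> E"
  shows "C = {}"
  using assms
proof (induction rule: grown_tree.induct)
  case root
  then show ?case by blast
next
  case (leaf S u w)
  have "w \<notin> C"
  proof
    assume "w \<in> C"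
    then obtain x y where "x \<in> C" "y \<in> C" "x \<noteq> y" "(x, w) \<in> E" "(y, w) \<in> E"
      using leaf.prems(4) by blast
    \<comment> \<open>Irreflexivity makes \<open>x\<close> and \<open>y\<close> differ from
      \<open>w\<close>, so both lie in \<open>S\<close>.\<close>
    moreover have "(w, w) \<notin> E" using leaf.prems(2) by (auto simp: irrefl_def)
    ultimately have "{x, y} \<subseteq> {x \<in> S. (x, w) \<in> E}" using leaf.prems(3) by blast
    with leaf.hyps \<open>x \<noteq> y\<close> show False by auto
  qed
  with leaf show ?case by blast
qed

section \<open>Connected vertex sets and components\<close>

text \<open>Connectedness of the subgraph induced on \<open>S\<close>, stated for vertex sets under
  a fixed \<open>E\<close> so that the induction can pass to subsets without building
  graphs.\<close>

definition linked :: "'a rel \<Rightarrow> 'a set \<Rightarrow> bool" where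
  "linked E S \<longleftrightarrow> S \<noteq> {} \<and> (\<forall>x\<in>S. \<forall>y\<in>S. (x, y) \<in> rtrancl_on S E)"

definition comps :: "'a rel \<Rightarrow> 'a set \<Rightarrow> 'a set set" where
  "comps E W = W // rtrancl_on W E"

lemma equiv_rtrancl_on: "sym E \<Longrightarrow> equiv W (rtrancl_on W E)"
  by (intro equivI refl_onI rtrancl_on_sym transI)
    (auto intro: rtrancl_on_trans dest: in_rtrancl_on_in_F)

text \<open>A walk inside \<open>W\<close> that starts in a class stays in it, so the class is
  connected by walks within itself.\<close>

lemma comps_linked:
  assumes "sym E" "b \<in> comps E W"
  shows "linked E b"
proof -
  obtain x where x: "x \<in> W" "b = rtrancl_on W E `` {x}"
    using assms(2) by (auto simp: comps_def elim: quotientE)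
  have "(x, y) \<in> rtrancl_on b E" if "(x, y) \<in> rtrancl_on W E" for y
    using that
  proof (induction rule: rtrancl_on_induct)
    case base
    then show ?case using x by auto
  next
    case (step y z)
    then have "z \<in> b" using x by (auto intro: rtrancl_on_into_rtrancl_on)
    with step show ?case by (auto intro: rtrancl_on_into_rtrancl_on)
  qed
  then have xb: "(x, y) \<in> rtrancl_on b E" if "y \<in> b" for y using that x by auto
  show ?thesis unfolding linked_def
  proof (intro conjI ballI)
    show "b \<noteq> {}" using x by auto
    fix y z assume "y \<in> b" "z \<in> b"
    then show "(y, z) \<in> rtrancl_on b E"
      using xb rtrancl_on_sym[OF assms(1), of b] by (meson rtrancl_on_trans symD)
  qed
qed

lemma comps_closed:
  assumes "sym E" "b \<in> comps E W" "x \<in> b" "y \<in> W" "(x, y) \<in> E"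
  shows "y \<in> b"
  using assms by (auto simp: comps_def elim!: quotientE intro: rtrancl_on_into_rtrancl_on)

lemma comps_partition:
  assumes "sym E"
  shows "\<Union> (comps E W) = W" "\<And>b c. b \<in> comps E W \<Longrightarrow> c \<in> comps E W \<Longrightarrow> b = c \<or> b \<inter> c = {}"
  using Union_quotient[OF equiv_rtrancl_on[OF assms, of W]]
    quotient_disj[OF equiv_rtrancl_on[OF assms, of W]]
  by (auto simp: comps_def)

lemma linked_insert:
  assumes "sym E" "linked E b" "x \<in> b" "(u, x) \<in> E"
  shows "linked E (insert u b)"
proof -
  have b: "(x, y) \<in> rtrancl_on (insert u b) E" if "y \<in> insert u b" for y
  proof (cases "y \<in> b")
    case True
    then have "(x, y) \<in> rtrancl_on b E" using assms by (auto simp: linked_def)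
    then show ?thesis by (rule rtrancl_on_mono[rotated 2]) auto
  next
    case False
    with that assms show ?thesis
      by (auto dest: symD intro!: rtrancl_on_into_rtrancl_on[of x x])
  qed
  then show ?thesis
    using rtrancl_on_sym[OF assms(1), of "insert u b"] unfolding linked_def
    by (meson insert_not_empty rtrancl_on_trans symD)
qed

lemma linked_crossing_edge:
  assumes "linked E V" "b \<subseteq> V" "b \<noteq> {}" "v \<in> V - b"
  obtains x y where "x \<in> V - b" "y \<in> b" "(x, y) \<in> E"
proof -
  obtain z where "z \<in> b" using assms by blast
  then have "(v, z) \<in> rtrancl_on V E" using assms by (auto simp: linked_def)
  \<comment> \<open>The walk starts outside \<open>b\<close>; once it is in \<open>b\<close>, some
    step has entered \<open>b\<close>.\<close>
  then have "z \<in> b \<longrightarrow> (\<exists>x y. x \<in> V - b \<and> y \<in> b \<and> (x, y) \<in> E)"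
    by (induction rule: rtrancl_on_induct) (use assms in auto)
  with \<open>z \<in> b\<close> that show ?thesis by blast
qed

section \<open>Attaching trees in separate components\<close>

text \<open>The two inclusions carry the induction: one keeps the attachment points available, the
  other keeps \<open>S\<close> off the components not yet used. Each \<open>u b\<close> is already
  counted in \<open>S0\<close>, hence the \<open>- 1\<close>.\<close>

lemma grown_tree_attach:
  assumes "finite B" "grown_tree E r S0"
    and "\<And>b. b \<in> B \<Longrightarrow> b \<inter> S0 = {}"
    and "\<And>b c x y. b \<in> B \<Longrightarrow> c \<in> B \<Longrightarrow> b \<noteq> c \<Longrightarrow> x \<in> b \<Longrightarrow> y \<in> c \<Longrightarrow> x \<noteq> y \<and> (x, y) \<notin> E"
    and "\<And>b. b \<in> B \<Longrightarrow> u b \<in> S0 \<and> grown_tree E (u b) (T b) \<and> T b \<subseteq> insert (u b) b"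
    and "\<And>b x y. b \<in> B \<Longrightarrow> x \<in> S0 - {u b} \<Longrightarrow> y \<in> b \<Longrightarrow> (x, y) \<notin> E"
  shows "\<exists>S. grown_tree E r S \<and> S0 \<subseteq> S \<and> S \<subseteq> S0 \<union> \<Union> B \<and>
    card S = card S0 + (\<Sum>b\<in>B. card (T b) - 1)"
  using assms
proof (induction B)
  case empty
  then show ?case by auto
next
  case (insert b B)
  have "\<exists>S. grown_tree E r S \<and> S0 \<subseteq> S \<and> S \<subseteq> S0 \<union> \<Union> B \<and>
    card S = card S0 + (\<Sum>b\<in>B. card (T b) - 1)"
  proof (rule insert.IH)
    show "grown_tree E r S0" by fact
    show "c \<inter> S0 = {}" if "c \<in> B" for c using insert.prems(2) that by simp
    show "x \<noteq> y \<and> (x, y) \<notin> E" if "c \<in> B" "d \<in> B" "c \<noteq> d" "x \<in> c" "y \<in> d" for c d x y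
      using insert.prems(3)[of c d x y] that by simp
    show "u c \<in> S0 \<and> grown_tree E (u c) (T c) \<and> T c \<subseteq> insert (u c) c" if "c \<in> B" for c
      using insert.prems(4) that by simp
    show "(x, y) \<notin> E" if "c \<in> B" "x \<in> S0 - {u c}" "y \<in> c" for c x y
      using insert.prems(5)[of c x y] that by simp
  qed
  then obtain S where S: "grown_tree E r S" "S0 \<subseteq> S" "S \<subseteq> S0 \<union> \<Union> B"
    "card S = card S0 + (\<Sum>b\<in>B. card (T b) - 1)" by blast
  have T: "u b \<in> S0" "grown_tree E (u b) (T b)" "T b \<subseteq> insert (u b) b"
    using insert.prems by auto
  have uT: "u b \<in> T b" using T(2) by (rule grown_tree_root_mem)
  have dis: "b \<inter> c = {}" if "c \<in> B" for c
    using insert.prems(3)[of b c] insert.hyps(2) that by fastforce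
  have int: "S \<inter> T b = {u b}"
    using S T uT insert.prems(2)[of b] dis by blast
  \<comment> \<open>An edge into \<open>b\<close> could come from \<open>S0\<close>, where only
    \<open>u b\<close> may be adjacent to \<open>b\<close>, or from another component.\<close>
  have "(x, y) \<notin> E" if "x \<in> S - {u b}" "y \<in> T b - {u b}" for x y
  proof -
    have y: "y \<in> b" using that T by auto
    show ?thesis
    proof (cases "x \<in> S0")
      case True
      then show ?thesis using insert.prems(5)[of b x y] that y by simp
    next
      case False
      then have "x \<in> \<Union> B" using S(3) that(1) by blast
      then obtain c where "c \<in> B" "x \<in> c" by blast
      then show ?thesis using insert.prems(3)[of c b x y] insert.hyps y by auto
    qed
  qed
  then have "grown_tree E r (S \<union> T b)" using T S int by (intro grown_tree_union)
  moreover have "card (S \<union> T b) = card S0 + (\<Sum>b\<in>insert b B. card (T b) - 1)"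
  proof -
    have fin: "finite S" "finite (T b)" using S(1) T(2) by (auto dest: grown_tree_finite)
    then have "card (T b) \<ge> 1" using uT by (auto simp: Suc_le_eq card_gt_0_iff)
    moreover have "card (S \<union> T b) + 1 = card S + card (T b)"
      using card_Un_Int[OF fin] int by simp
    ultimately show ?thesis using S(4) insert.hyps by simp
  qed
  moreover have "S0 \<subseteq> S \<union> T b" "S \<union> T b \<subseteq> S0 \<union> \<Union> (insert b B)"
    using S(2,3) T(1,3) by auto
  ultimately show ?case by blast
qed

section \<open>Induction on the number of vertices\<close>

lemma linked_exists_large_grown_tree:
  assumes "sym E" "irrefl E" and tri: "\<And>x y z. (x, y) \<in> E \<Longrightarrow> (y, z) \<in> E \<Longrightarrow> (z, x) \<notin> E"
    and "finite V" "linked E V" "v \<in> V"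
  shows "\<exists>S\<subseteq>V. grown_tree E v S \<and> card V \<le> card S ^ 11"
  using assms(4-)
proof (induction "card V" arbitrary: V v rule: less_induct)
  case less
  note fin = less.prems(1)
  define A where "A = {a \<in> V. (v, a) \<in> E}"
  define W where "W = V - insert v A"
  define B where "B = comps E W"
  define N where "N b = {a \<in> A. \<exists>x\<in>b. (a, x) \<in> E}" for b
  \<comment> \<open>This is the order of the tree that the induction guarantees in
    \<open>insert a b\<close>, the same for every \<open>a\<close> in \<open>N b\<close>.\<close>
  define z where "z b = (LEAST k. card b < k ^ 11)" for b :: "'a set"
  define Z where "Z = Max (card ` {S. S \<subseteq> V \<and> grown_tree E v S})"
  have A: "A \<subseteq> V" "v \<notin> A" using assms(2) by (auto simp: A_def irrefl_def)
  have finA: "finite A" using A fin finite_subset by blast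
  have UB: "\<Union> B = W" unfolding B_def by (rule comps_partition[OF assms(1)])
  then have finB: "finite B" using fin by (metis W_def finite_Diff finite_UnionD)
  have disB: "b \<inter> c = {}" if "b \<in> B" "c \<in> B" "b \<noteq> c" for b c
    using comps_partition(2)[OF assms(1)] that unfolding B_def by blast
  have B: "b \<subseteq> V" "v \<notin> b" "b \<inter> A = {}" "finite b" "linked E b" if "b \<in> B" for b
  proof -
    show "b \<subseteq> V" "v \<notin> b" "b \<inter> A = {}" using UB that W_def by auto
    then show "finite b" using fin finite_subset by blast
    show "linked E b" using that assms(1) unfolding B_def by (rule comps_linked[rotated])
  qed
  have noedge: "(x, y) \<notin> E" if "b \<in> B" "c \<in> B" "b \<noteq> c" "x \<in> b" "y \<in> c" for b c x y
    using comps_closed[OF assms(1) that(1)[unfolded B_def] that(4), of y] disB[OF that(1-3)]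
      UB that by blast
  \<comment> \<open>The outer end of an edge entering \<open>b\<close> is not in \<open>W\<close>,
    since components are closed, and is not \<open>v\<close>, since \<open>b\<close> avoids
    \<open>A\<close>.\<close>
  have N: "N b \<subseteq> A \<and> N b \<noteq> {}" if b: "b \<in> B" for b
  proof -
    have "b \<noteq> {}" using B(5)[OF b] by (simp add: linked_def)
    with B(1,2)[OF b] less.prems obtain x y where xy: "x \<in> V - b" "y \<in> b" "(x, y) \<in> E"
      using linked_crossing_edge[of E V b v] by blast
    have "x \<notin> W"
    proof
      assume "x \<in> W"
      with xy comps_closed[OF assms(1) b[unfolded B_def], of y x] show False
        using symD[OF assms(1)] by blast
    qed
    moreover have "x \<noteq> v" using xy B[OF b] unfolding A_def by blast
    ultimately have "x \<in> A" using xy unfolding W_def by blast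
    with xy show ?thesis by (auto simp: N_def)
  qed
  have z: "card b < z b ^ 11" for b
    unfolding z_def by (rule LeastI[of _ "Suc (card b)"]) (simp add: less_le_trans[OF _ self_le_power])
  have z2: "2 \<le> z b" if b: "b \<in> B" for b
  proof (rule ccontr)
    assume "\<not> 2 \<le> z b"
    then have "z b \<le> 1" by simp
    then have "z b ^ 11 \<le> 1" using power_mono[of "z b" 1 11] by simp
    with z[of b] have "card b = 0" by simp
    with B[OF b] show False by (simp add: linked_def)
  qed
  have finT: "finite {S. S \<subseteq> V \<and> grown_tree E v S}"
    by (rule finite_subset[of _ "Pow V"]) (use fin in auto)
  have Z: "card S \<le> Z" if "S \<subseteq> V" "grown_tree E v S" for S
    unfolding Z_def by (rule Max_ge) (use that finT in auto)
  have subtree: "\<exists>T. T \<subseteq> insert a b \<and> grown_tree E a T \<and> z b \<le> card T"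
    if b: "b \<in> B" and a: "a \<in> N b" for a b
  proof -
    have aA: "a \<in> A" and ab: "a \<notin> b" using a B[OF b] by (auto simp: N_def)
    \<comment> \<open>The inclusion is proper because \<open>v\<close> is missing.\<close>
    have "insert a b \<subset> V" using B[OF b] A aA less.prems by blast
    then have "card (insert a b) < card V" using fin by (rule psubset_card_mono[rotated])
    moreover have "linked E (insert a b)"
      using a linked_insert[OF assms(1) B(5)[OF b]] by (auto simp: N_def)
    ultimately obtain T where T: "T \<subseteq> insert a b" "grown_tree E a T"
      "card (insert a b) \<le> card T ^ 11"
      using less.hyps[of "insert a b" a] B[OF b] by blast
    \<comment> \<open>The extra vertex \<open>a\<close> supplies the strict inequality in the
      definition of \<open>z b\<close>.\<close>
    with ab B[OF b] have "card b < card T ^ 11" by simp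
    then have "z b \<le> card T" unfolding z_def by (rule Least_le)
    with T show ?thesis by blast
  qed
  have "1 + card A + (\<Sum>b\<in>B. z b ^ 11 - 1) \<le> Z ^ 11"
  proof (rule sum_powers_le_of_unique_covers[OF finA finB N z2])
    fix A' B' assume A': "A' \<subseteq> A" and B': "B' \<subseteq> B" and uniq: "\<forall>b\<in>B'. card (N b \<inter> A') = 1"
    have "\<forall>b\<in>B'. \<exists>a. N b \<inter> A' = {a}" using uniq by (metis card_1_singletonE)
    then obtain u where u: "\<And>b. b \<in> B' \<Longrightarrow> N b \<inter> A' = {u b}" by metis
    have "\<forall>b\<in>B'. \<exists>T. T \<subseteq> insert (u b) b \<and> grown_tree E (u b) T \<and> z b \<le> card T"
      using subtree u B' by blast
    then obtain T where T: "\<And>b. b \<in> B' \<Longrightarrow>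
      T b \<subseteq> insert (u b) b \<and> grown_tree E (u b) (T b) \<and> z b \<le> card (T b)" by metis
    have finA': "finite A'" and finB': "finite B'"
      using A' B' finA finB finite_subset by blast+
    have star: "grown_tree E v (insert v A')"
    proof (rule grown_tree_star[OF finA'])
      \<comment> \<open>An edge inside \<open>A'\<close> would close a triangle with
        \<open>v\<close>.\<close>
      show "(a, b) \<notin> E" if "a \<in> A'" "b \<in> A'" for a b
        using that A' tri[of v a b] symD[OF assms(1)] unfolding A_def by blast
    qed (use A' A in \<open>auto simp: A_def\<close>)
    have "\<exists>S. grown_tree E v S \<and> insert v A' \<subseteq> S \<and> S \<subseteq> insert v A' \<union> \<Union> B' \<and>
      card S = card (insert v A') + (\<Sum>b\<in>B'. card (T b) - 1)"
    proof (rule grown_tree_attach[OF finB' star, where u = u])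
      show "b \<inter> insert v A' = {}" if "b \<in> B'" for b using B[of b] B' A' that by blast
      show "x \<noteq> y \<and> (x, y) \<notin> E" if "b \<in> B'" "c \<in> B'" "b \<noteq> c" "x \<in> b" "y \<in> c" for b c x y
        using disB[of b c] noedge[of b c x y] that B' by blast
      show "u b \<in> insert v A' \<and> grown_tree E (u b) (T b) \<and> T b \<subseteq> insert (u b) b"
        if "b \<in> B'" for b using u[OF that] T[OF that] by blast
      \<comment> \<open>The root \<open>v\<close> has no neighbour in \<open>b\<close>, and unique
        covering leaves \<open>u b\<close> as the only one in \<open>A'\<close>.\<close>
      show "(x, y) \<notin> E" if "b \<in> B'" "x \<in> insert v A' - {u b}" "y \<in> b" for b x y
      proof
        assume xy: "(x, y) \<in> E"
        have "y \<in> V - A" using B[of b] B' that by blast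
        with xy have "x \<noteq> v" by (auto simp: A_def)
        with that have "x \<in> A'" by blast
        moreover from this have "x \<in> N b" using A' xy that by (auto simp: N_def)
        ultimately show False using u[OF that(1)] that(2) by blast
      qed
    qed
    then obtain S where S: "grown_tree E v S" "S \<subseteq> insert v A' \<union> \<Union> B'"
      "card S = card (insert v A') + (\<Sum>b\<in>B'. card (T b) - 1)" by blast
    have "S \<subseteq> V" using S(2) A A' B' UB less.prems unfolding W_def by blast
    with S have "card (insert v A') + (\<Sum>b\<in>B'. card (T b) - 1) \<le> Z" using Z by metis
    moreover have "card (insert v A') = 1 + card A'" using A A' finA' by (subst card_insert_disjoint) auto
    moreover have "(\<Sum>b\<in>B'. z b - 1) \<le> (\<Sum>b\<in>B'. card (T b) - 1)"
      using T by (intro sum_mono diff_le_mono) blast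
    ultimately show "1 + card A' + (\<Sum>b\<in>B'. z b - 1) \<le> Z" by linarith
  qed
  moreover have "card V \<le> 1 + card A + (\<Sum>b\<in>B. z b ^ 11 - 1)"
  proof -
    have "V = insert v A \<union> W" using A less.prems unfolding W_def by blast
    then have "card V \<le> card (insert v A) + card W" by (metis card_Un_le)
    moreover have "card (insert v A) = 1 + card A" using A finA by simp
    moreover have "card W \<le> (\<Sum>b\<in>B. card b)" unfolding UB[symmetric] by (rule card_Union_le_sum_card)
    moreover have "card b \<le> z b ^ 11 - 1" for b using z[of b] by linarith
    then have "(\<Sum>b\<in>B. card b) \<le> (\<Sum>b\<in>B. z b ^ 11 - 1)" by (rule sum_mono)
    ultimately show ?thesis by linarith
  qed
  moreover obtain S where "S \<subseteq> V" "grown_tree E v S" "card S = Z"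
  proof -
    have "{v} \<in> {S. S \<subseteq> V \<and> grown_tree E v S}" using less.prems grown_tree.root by simp
    then have "Z \<in> card ` {S. S \<subseteq> V \<and> grown_tree E v S}"
      unfolding Z_def using finT by (intro Max_in) auto
    then show thesis using that by auto
  qed
  ultimately show ?case by (intro exI[of _ S]) simp
qed

section \<open>Transfer to induced subgraphs and to \<open>f_T\<close>\<close>

lemma (in graph) grown_tree_imp_ugraph_tree:
  assumes S: "grown_tree (arcs_ends G) r S"
  shows "ugraph_tree (G \<restriction> S)"
proof -
  let ?H = "G \<restriction> S"
  interpret H: wf_digraph ?H by (rule wellformed_induce_subgraph)
  have symE: "sym (arcs_ends G)" using sym_arcs by (simp add: symmetric_def)
  have irr: "irrefl (arcs_ends G)" using adj_not_same by (auto simp: irrefl_def)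
  have reach: "u \<rightarrow>\<^sup>*\<^bsub>?H\<^esub> v" if "(u, v) \<in> rtrancl_on S (arcs_ends G)" for u v
    using that
  proof (induction rule: rtrancl_on_induct)
    case base
    then show ?case by (auto simp: reachable_def)
  next
    case (step y w)
    then have "y \<rightarrow>\<^bsub>?H\<^esub> w" by (auto simp: arcs_ends_conv)
    with step show ?case by (auto simp: reachable_def intro: rtrancl_on_into_rtrancl_on)
  qed
  have "(u, v) \<in> rtrancl_on S (arcs_ends G)" if "u \<in> S" "v \<in> S" for u v
    using grown_tree_rtrancl_on[OF S symE] rtrancl_on_sym[OF symE, of S] that
    by (meson rtrancl_on_trans symD)
  then have "Digraph_Component.connected ?H"
    unfolding connected_def strongly_connected_def
    using grown_tree_root_mem[OF S] reach H.reachable_mk_symmetricI by auto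
  moreover have "ugraph_acyclic ?H"
    unfolding ugraph_acyclic_def
  proof (rule notI, elim exE conjE)
    fix p assume "pre_digraph.cycle ?H p" and len: "3 \<le> length p"
    then obtain u where u: "H.awalk u p u" "distinct (tl (H.awalk_verts u p))"
      by (auto simp: H.cycle_def)
    then have cas: "H.cas u p u" and arcs: "set p \<subseteq> arcs ?H" by (auto simp: H.awalk_def)
    have dist: "distinct (map (head G) p)"
      using u(2) H.awalk_verts_conv'[OF cas] len by (cases p) auto
    \<comment> \<open>The recursive \<open>cas\<close> in indexed form, with a free end vertex so
      that induction on the arc list applies.\<close>
    have cas_nth: "(p \<noteq> [] \<longrightarrow> tail G (p ! 0) = u \<and> head G (last p) = v) \<and>
        (\<forall>i. Suc i < length p \<longrightarrow> tail G (p ! Suc i) = head G (p ! i))"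
      if "H.cas u p v" for u v p
      using that
    proof (induction p arbitrary: u)
      case (Cons e p)
      then have "H.cas (head G e) p v" "tail G e = u" by simp_all
      with Cons.IH[of "head G e"] show ?case by (auto simp: nth_Cons split: nat.split)
    qed simp
    have next_arc: "tail G (p ! Suc i) = head G (p ! i)" if "Suc i < length p" for i
      using cas_nth[OF cas] that by blast
    have closed: "tail G (p ! 0) = head G (p ! (length p - 1))"
      using cas_nth[OF cas] len last_conv_nth[of p] by force
    have edge: "(tail G e, head G e) \<in> arcs_ends G" "head G e \<in> S" if "e \<in> set p" for e
      using that arcs by (auto simp: arcs_ends_conv)
    have "head G ` set p = {}"
    proof (rule grown_tree_no_core[OF S symE irr])
      show "head G ` set p \<subseteq> S" using edge by auto
      fix c assume "c \<in> head G ` set p"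
      then obtain i where i: "i < length p" "c = head G (p ! i)" by (auto simp: in_set_conv_nth)
      \<comment> \<open>The indices after and before \<open>i\<close> around the cycle. The heads of
        these arcs are the two neighbours of \<open>c\<close>; length at least 3 makes them
        different.\<close>
      define j where "j = (if Suc i = length p then 0 else Suc i)"
      define l where "l = (if i = 0 then length p - 1 else i - 1)"
      have jl: "j < length p" "l < length p" "j \<noteq> l" using i len by (auto simp: j_def l_def)
      have "tail G (p ! i) = head G (p ! l)"
        using next_arc[of "i - 1"] closed i by (auto simp: l_def)
      then have "(head G (p ! l), c) \<in> arcs_ends G" using edge(1)[of "p ! i"] i by auto
      moreover have "tail G (p ! j) = c"
      proof (cases "Suc i = length p")
        case True
        then have "i = length p - 1" by simp
        with True closed i(2) show ?thesis by (simp add: j_def)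
      next
        case False
        with next_arc[of i] i show ?thesis by (simp add: j_def)
      qed
      then have "(head G (p ! j), c) \<in> arcs_ends G"
        using edge(1)[of "p ! j"] jl symD[OF symE] by auto
      moreover have "head G (p ! l) \<noteq> head G (p ! j)"
        using dist jl nth_eq_iff_index_eq[of "map (head G) p" l j] by simp
      ultimately show "\<exists>x\<in>head G ` set p. \<exists>y\<in>head G ` set p.
          x \<noteq> y \<and> (x, c) \<in> arcs_ends G \<and> (y, c) \<in> arcs_ends G"
        using jl by (metis imageI nth_mem)
    qed
    with len show False by auto
  qed
  ultimately show ?thesis by (simp add: ugraph_tree_def)
qed

lemma (in graph) card_verts_le_max_induced_tree_power:
  assumes "Digraph_Component.connected G" "triangle_free G"
  shows "card (verts G) \<le> max_induced_tree G ^ 11"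
proof -
  let ?E = "arcs_ends G"
  have symE: "sym ?E" using sym_arcs by (simp add: symmetric_def)
  have irr: "irrefl ?E" using adj_not_same by (auto simp: irrefl_def)
  \<comment> \<open>\<open>connected\<close> refers to the symmetric closure, which has the same
    reachability here because the arcs are symmetric.\<close>
  have linked: "linked ?E (verts G)"
    using assms(1) reachable_mk_symmetric_eq[OF sym_arcs]
    by (auto simp: connected_def strongly_connected_def linked_def reachable_def)
  then obtain v where "v \<in> verts G" by (auto simp: linked_def)
  then obtain S where S: "S \<subseteq> verts G" "grown_tree ?E v S" "card (verts G) \<le> card S ^ 11"
    using linked_exists_large_grown_tree[OF symE irr _ finite_verts linked] assms(2)
    unfolding triangle_free_def by blast
  have "card S \<le> max_induced_tree G"
    unfolding max_induced_tree_def
  proof (rule Max_ge[OF max_induced_tree_finite[OF finite_verts]])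
    have "induced_subgraph (G \<restriction> S) G" using S(1) by (rule induced_induce)
    with grown_tree_imp_ugraph_tree[OF S(2)]
    show "card S \<in> {card (verts H) |H. induced_subgraph H G \<and> ugraph_tree H}"
      by (metis (mono_tags, lifting) induce_subgraph_verts mem_Collect_eq)
  qed
  then have "card S ^ 11 \<le> max_induced_tree G ^ 11" by (rule power_mono) simp
  with S(3) show ?thesis by linarith
qed

lemma le_f_T_power:
  assumes "n \<ge> 1"
  shows "n \<le> f_T n ^ 11"
proof -
  have "f_T n \<in> {max_induced_tree (with_proj G) | G :: nat pair_pre_digraph.
     pair_graph G \<and> card (pverts G) = n \<and>
     Digraph_Component.connected (with_proj G) \<and> triangle_free (with_proj G)}"
    unfolding f_T_def by (rule Min_in[OF f_T_finite f_T_nonempty[OF assms]])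
  then obtain G :: "nat pair_pre_digraph" where G: "f_T n = max_induced_tree (with_proj G)"
    "pair_graph G" "card (pverts G) = n"
    "Digraph_Component.connected (with_proj G)" "triangle_free (with_proj G)" by blast
  then show ?thesis
    using graph.card_verts_le_max_induced_tree_power[OF pair_graph.pair_graphD_graph[OF G(2)]]
    by simp
qed

theorem theorem1p2:
  shows "\<exists>c::real. c > 0 \<and> (\<forall>n::nat. n \<ge> 1 \<longrightarrow> real (f_T n) \<ge> exp (c * sqrt (ln (real n))))"
\<comment> \<open>\<open>22 = 11 * 2\<close>: the 11 is the exponent of the polynomial bound, the 2
  comes from \<open>sqrt x <= 2 * x\<close>.\<close>
proof (intro exI[of _ "1/22"] conjI allI impI)
  fix n :: nat assume n: "n \<ge> 1"
  have t: "n \<le> f_T n ^ 11" using n by (rule le_f_T_power)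
  then have pos: "0 < f_T n" using n by (cases "f_T n") auto
  have "real n \<le> real (f_T n) ^ 11" using t by (metis of_nat_le_iff of_nat_power)
  then have "ln (real n) \<le> ln (real (f_T n) ^ 11)" using n pos by (intro ln_mono) auto
  then have L: "ln (real n) \<le> 11 * ln (real (f_T n))" using pos by (simp add: ln_realpow)
  \<comment> \<open>This needs \<open>ln n\<close> to be 0 or at least \<open>1 / 4\<close>. For
    \<open>n >= 2\<close>, \<open>ln (1 / 2) <= - 1 / 2\<close> even gives
    \<open>1 / 2 <= ln 2\<close>.\<close>
  have "sqrt (ln (real n)) \<le> 2 * ln (real n)"
  proof (cases "n = 1")
    case False
    then have "ln 2 \<le> ln (real n)" using n by (intro ln_mono) auto
    moreover have "ln (1 / 2) \<le> (1 / 2 :: real) - 1" by (rule ln_le_minus_one) simp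
    ultimately have "1 / 4 \<le> ln (real n)" by (simp add: ln_div)
    then have "ln (real n) * 1 \<le> ln (real n) * (4 * ln (real n))" by (intro mult_left_mono) auto
    then show ?thesis using \<open>1 / 4 \<le> ln (real n)\<close>
      by (intro real_le_lsqrt) (auto simp: power2_eq_square)
  qed simp
  with L have "1 / 22 * sqrt (ln (real n)) \<le> ln (real (f_T n))" by linarith
  then show "exp (1 / 22 * sqrt (ln (real n))) \<le> real (f_T n)"
    using pos by (metis exp_le_cancel_iff exp_ln of_nat_0_less_iff)
qed simp

end
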